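(* Let $\mathbb C$ and $\mathbb D$ be finite disjoint unions of (directed) cycles, with sets of cycle lengths $C$ and $D$ respectively. Then $\mathbb D\leq\mathbb C$ if and only if for all $c\in\mathbb N^+$ such that every number in $C\mathbin{\dot-} c$ is a multiple of some prime in $C\mathbin{\dot-} c$, there is a map $h\colon (C\mathbin{\dot-} c)\to D$ such that for all $a\in D$, $$a\text{ does not divide }\operatorname{lcm}\bigl(\{h(b)\mathbin{\dot-} b \mid b\in (C\mathbin{\dot-} c)\}\bigr).$$
   Context: Here $\mathbin{\dot-}$ denotes the following division-like operation (not subtraction): for $a,c\in\mathbb N^+$, $a\mathbin{\dot-} c:=\frac{a}{\gcd(a,c)}$, and for a set $C\subset\mathbb N^+$, $C\mathbin{\dot-} c:=\{a\mathbin{\dot-} c\mid a\in C\}$. A finite disjoint union of cycles is a finite (nonempty) digraph in which every vertex has exactly one incoming and exactly one outgoing edge; its set of cycle lengths is the set of all $a\in\mathbb N^+$ such that it contains a directed cycle of length $a$ as a component. A primitive positive (pp) formula is a first-order formula built from atomic formulas $R(x_1,\dots,x_n)$, $x\approx y$, and the always-false formula $\bot$ using only conjunction and existential quantification. A structure is a pp-power of $\mathbb A$ if it is isomorphic to a structure with domain $A^n$ for some $n\geq 1$ whose relations are pp-definable in $\mathbb A$ (a $k$-ary relation on $A^n$ being regarded as a $kn$-ary relation on $A$). $\mathbb A\leq\mathbb B$ ("$\mathbb A$ pp-constructs $\mathbb B$") means that $\mathbb B$ is homomorphically equivalent to a pp-power of $\mathbb A$. *)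

theory Defs
  imports
    "HOL-Library.FuncSet"
    "HOL-Computational_Algebra.Primes"
    "Graph_Theory.Digraph_Component"
begin

section \<open>Relational structures\<close>

text \<open>The signature of a structure is the whole type \<open>'r\<close> of relation symbols, with arities
  given by \<open>arity_of\<close>; tuples are lists.\<close>

record ('r, 'a) rel_struct =
  dom_of :: "'a set"
  arity_of :: "'r \<Rightarrow> nat"
  rel_of :: "'r \<Rightarrow> 'a list set"

definition tuples :: "nat \<Rightarrow> 'a set \<Rightarrow> 'a list set" where
  "tuples n A = {xs. set xs \<subseteq> A \<and> length xs = n}"

definition is_structure :: "('r, 'a) rel_struct \<Rightarrow> bool" where
  "is_structure A \<longleftrightarrow>
     dom_of A \<noteq> {} \<and> (\<forall>r. rel_of A r \<subseteq> tuples (arity_of A r) (dom_of A))"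

definition is_hom :: "('r, 'a) rel_struct \<Rightarrow> ('r, 'b) rel_struct \<Rightarrow> ('a \<Rightarrow> 'b) \<Rightarrow> bool" where
  "is_hom A B f \<longleftrightarrow>
     arity_of A = arity_of B \<and> f \<in> dom_of A \<rightarrow> dom_of B \<and>
     (\<forall>r. \<forall>xs \<in> rel_of A r. map f xs \<in> rel_of B r)"

definition hom_equivalent :: "('r, 'a) rel_struct \<Rightarrow> ('r, 'b) rel_struct \<Rightarrow> bool" where
  "hom_equivalent A B \<longleftrightarrow> (\<exists>f. is_hom A B f) \<and> (\<exists>g. is_hom B A g)"

definition isomorphic :: "('r, 'a) rel_struct \<Rightarrow> ('r, 'b) rel_struct \<Rightarrow> bool" where
  "isomorphic A B \<longleftrightarrow>
     arity_of A = arity_of B \<and>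
     (\<exists>f. bij_betw f (dom_of A) (dom_of B) \<and> (\<forall>r. rel_of B r = map f ` rel_of A r))"

section \<open>Primitive positive formulas\<close>

datatype 'r pp_formula =
    Rel 'r "nat list"
  | Eq nat nat
  | Bot
  | And "'r pp_formula" "'r pp_formula"
  | Ex nat "'r pp_formula"

primrec pp_wf :: "('r \<Rightarrow> nat) \<Rightarrow> 'r pp_formula \<Rightarrow> bool" where
  "pp_wf ar (Rel r xs) \<longleftrightarrow> length xs = ar r"
| "pp_wf ar (Eq x y) \<longleftrightarrow> True"
| "pp_wf ar Bot \<longleftrightarrow> True"
| "pp_wf ar (And \<phi> \<psi>) \<longleftrightarrow> pp_wf ar \<phi> \<and> pp_wf ar \<psi>"
| "pp_wf ar (Ex x \<phi>) \<longleftrightarrow> pp_wf ar \<phi>"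

primrec pp_fv :: "'r pp_formula \<Rightarrow> nat set" where
  "pp_fv (Rel r xs) = set xs"
| "pp_fv (Eq x y) = {x, y}"
| "pp_fv Bot = {}"
| "pp_fv (And \<phi> \<psi>) = pp_fv \<phi> \<union> pp_fv \<psi>"
| "pp_fv (Ex x \<phi>) = pp_fv \<phi> - {x}"

primrec pp_sat :: "('r, 'a) rel_struct \<Rightarrow> (nat \<Rightarrow> 'a) \<Rightarrow> 'r pp_formula \<Rightarrow> bool" where
  "pp_sat A v (Rel r xs) \<longleftrightarrow> map v xs \<in> rel_of A r"
| "pp_sat A v (Eq x y) \<longleftrightarrow> v x = v y"
| "pp_sat A v Bot \<longleftrightarrow> False"
| "pp_sat A v (And \<phi> \<psi>) \<longleftrightarrow> pp_sat A v \<phi> \<and> pp_sat A v \<psi>"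
| "pp_sat A v (Ex x \<phi>) \<longleftrightarrow> (\<exists>a \<in> dom_of A. pp_sat A (v(x := a)) \<phi>)"

text \<open>The condition on free variables makes the junk values \<open>xs ! i\<close> for \<open>i \<ge> k\<close> irrelevant.\<close>

definition pp_definable :: "('r, 'a) rel_struct \<Rightarrow> nat \<Rightarrow> 'a list set \<Rightarrow> bool" where
  "pp_definable A k R \<longleftrightarrow>
     (\<exists>\<phi>. pp_wf (arity_of A) \<phi> \<and> pp_fv \<phi> \<subseteq> {..<k} \<and>
       R = {xs \<in> tuples k (dom_of A). pp_sat A (\<lambda>i. xs ! i) \<phi>})"

section \<open>Primitive positive powers and constructions\<close>

text \<open>A \<open>k\<close>-tuple of elements of \<open>A\<^sup>n\<close> is a list of \<open>k\<close> lists of length \<open>n\<close>; \<open>concat\<close> turns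
  it into the corresponding \<open>k * n\<close>-tuple over \<open>A\<close>.\<close>

definition is_pp_power :: "('r, 'a) rel_struct \<Rightarrow> ('s, 'b) rel_struct \<Rightarrow> bool" where
  "is_pp_power A B \<longleftrightarrow>
     (\<exists>n \<ge> 1. \<exists>P :: ('s, 'a list) rel_struct.
        is_structure P \<and> dom_of P = tuples n (dom_of A) \<and>
        (\<forall>s. pp_definable A (arity_of P s * n) (concat ` rel_of P s)) \<and>
        isomorphic P B)"

text \<open>The intermediate pp-power is taken over the type \<open>'a list\<close>. This loses nothing: every
  pp-power of \<open>A\<close>, over whatever type, is isomorphic to one over \<open>'a list\<close>.\<close>

definition pp_constructs :: "('r, 'a) rel_struct \<Rightarrow> ('s, 'b) rel_struct \<Rightarrow> bool" where
  "pp_constructs A B \<longleftrightarrow>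
     (\<exists>P :: ('s, 'a list) rel_struct. is_pp_power A P \<and> hom_equivalent P B)"

section \<open>Disjoint unions of cycles\<close>

definition digraph_struct :: "'a pair_pre_digraph \<Rightarrow> (unit, 'a) rel_struct" where
  "digraph_struct G =
     \<lparr>dom_of = pverts G, arity_of = (\<lambda>_. 2), rel_of = (\<lambda>_. {[u, v] |u v. (u, v) \<in> parcs G})\<rparr>"

definition finite_union_of_cycles :: "'a pair_pre_digraph \<Rightarrow> bool" where
  "finite_union_of_cycles G \<longleftrightarrow>
     pair_fin_digraph G \<and> pverts G \<noteq> {} \<and>
     (\<forall>v \<in> pverts G. in_degree (with_proj G) v = 1 \<and> out_degree (with_proj G) v = 1)"

text \<open>In Graph_Theory a cycle is a list of arcs, and a loop is a cycle of length 1. Here the cycle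
  is required to make up a whole (weakly) connected component \<open>H\<close>.\<close>

definition cycle_lengths :: "'a pair_pre_digraph \<Rightarrow> nat set" where
  "cycle_lengths G =
     {length p |p. pre_digraph.cycle (with_proj G) p \<and>
        (\<exists>H. pre_digraph.max_subgraph (with_proj G) connected H \<and> arcs H = set p)}"

lemma is_structure_digraph_struct:
  assumes "finite_union_of_cycles G"
  shows "is_structure (digraph_struct G)"
  using assms
  by (auto simp: finite_union_of_cycles_def is_structure_def digraph_struct_def tuples_def
      pair_fin_digraph_def dest: pair_wf_digraph.wellformed')

section \<open>The division-like operation\<close>

definition dotdiv :: "nat \<Rightarrow> nat \<Rightarrow> nat" (infixl \<open>\<ominus>\<close> 65) where
  "a \<ominus> c = a div gcd a c"

definition dotdiv_set :: "nat set \<Rightarrow> nat \<Rightarrow> nat set" (infixl \<open>\<ominus>\<^sub>s\<close> 65) where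
  "C \<ominus>\<^sub>s c = {a \<ominus> c |a. a \<in> C}"

end

theory Submission
  imports Defs "HOL-Combinatorics.Cycles"
begin

text \<open>
  The graphs are permutations of their vertex sets. Every map between powers of such graphs that is
  needed below is an equivariant map, and these exist as soon as the return times to each point of
  the source also fix some point of the target.

  If \<open>GD\<close> pp-constructs \<open>GC\<close> and no \<open>h\<close> exists for \<open>c\<close>, then \<open>GD\<close> has a polymorphism \<open>f\<close>, indexed by
  the vertices of \<open>GC\<close>, that is invariant under the \<open>c\<close>-th power of the successor map of \<open>GC\<close>: if
  moving a tuple \<open>i\<close> steps along \<open>GD\<close> has the same effect as permuting its entries along \<open>GC\<close>, then \<open>h b \<ominus> b\<close>
  divides \<open>i\<close>, where \<open>h b\<close> is the length of the cycle that contains a fixed entry of the tuple.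
  Such an \<open>f\<close> forces a closed walk of length \<open>c\<close> in \<open>GC\<close>, that is, \<open>1 \<in> C \<ominus>\<^sub>s c\<close>.

  Conversely, the polymorphisms \<open>GD ^ GC \<rightarrow> GD\<close>, with an edge from \<open>f\<close> to its reindexing along \<open>GC\<close>,
  are a pp-power of \<open>GD\<close> to which \<open>GC\<close> maps by the projections. There is a map back unless some \<open>f\<close>
  has a period \<open>k\<close> that is divisible by no element of \<open>C\<close>. A multiple \<open>c\<close> of \<open>k\<close> with this property
  and with \<open>C \<ominus>\<^sub>s c\<close> as small as possible satisfies the primality hypothesis, and \<open>h\<close> yields a tuple at
  which the invariance of \<open>f\<close> fails.
\<close>

section \<open>Cycles as orbits of the successor permutation\<close>

text \<open>The value \<open>v\<close> outside \<open>pverts G\<close> makes this a permutation of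
  the whole type that moves only vertices, so the theory of \<open>permutes\<close> and
  \<open>least_power\<close> applies.\<close>

definition next_vertex :: "'a pair_pre_digraph \<Rightarrow> 'a \<Rightarrow> 'a" where
  "next_vertex G v = (if v \<in> pverts G then THE w. (v, w) \<in> parcs G else v)"

lemma parcs_iff_next_vertex:
  assumes "finite_union_of_cycles G"
  shows "(v, w) \<in> parcs G \<longleftrightarrow> v \<in> pverts G \<and> w = next_vertex G v"
proof -
  interpret pair_fin_digraph G
    using assms by (simp add: finite_union_of_cycles_def)
  have ex1: "\<exists>!w. (v, w) \<in> parcs G" if v: "v \<in> pverts G"
  proof -
    have "card {e \<in> parcs G. fst e = v} = 1"
      using assms v by (simp add: finite_union_of_cycles_def out_degree_def out_arcs_def)
    then obtain e where e: "{e \<in> parcs G. fst e = v} = {e}"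
      by (auto simp: card_1_singleton_iff)
    show ?thesis
    proof
      show "(v, snd e) \<in> parcs G" using e by (metis (mono_tags, lifting) insertI1 mem_Collect_eq prod.collapse)
      show "w = snd e" if "(v, w) \<in> parcs G" for w
        using e that by (metis (mono_tags, lifting) fst_conv mem_Collect_eq singletonD snd_conv)
    qed
  qed
  have "(v, w) \<in> parcs G \<longleftrightarrow> w = next_vertex G v" if v: "v \<in> pverts G"
    using theI'[OF ex1[OF v]] the1_equality[OF ex1[OF v]]
    unfolding next_vertex_def if_P[OF v] by blast
  then show ?thesis
    using in_arcsD1[of v w] by blast
qed

lemma next_vertex_permutes:
  assumes "finite_union_of_cycles G"
  shows "next_vertex G permutes pverts G"
proof -
  interpret pair_fin_digraph G
    using assms by (simp add: finite_union_of_cycles_def)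
  note iff = parcs_iff_next_vertex[OF assms]
  have "inj_on (next_vertex G) (pverts G)"
  proof (rule inj_onI)
    fix x y assume xy: "x \<in> pverts G" "y \<in> pverts G" "next_vertex G x = next_vertex G y"
    then have "next_vertex G x \<in> pverts G"
      using iff in_arcsD2 by blast
    then have "card {e \<in> parcs G. snd e = next_vertex G x} = 1"
      using assms by (simp add: finite_union_of_cycles_def in_degree_def in_arcs_def)
    then obtain e where e: "{e \<in> parcs G. snd e = next_vertex G x} = {e}"
      by (auto simp: card_1_singleton_iff)
    have "(x, next_vertex G x) \<in> {e \<in> parcs G. snd e = next_vertex G x}"
      "(y, next_vertex G x) \<in> {e \<in> parcs G. snd e = next_vertex G x}"
      using xy iff by auto
    then show "x = y" unfolding e by auto
  qed
  moreover have "next_vertex G ` pverts G \<subseteq> pverts G"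
    using iff in_arcsD2 by blast
  ultimately have "bij_betw (next_vertex G) (pverts G) (pverts G)"
    unfolding bij_betw_def using endo_inj_surj[OF pair_finite_verts] by blast
  then show ?thesis
    by (rule bij_imp_permutes) (simp add: next_vertex_def)
qed

lemma permutation_next_vertex:
  assumes "finite_union_of_cycles G"
  shows "permutation (next_vertex G)"
  using assms next_vertex_permutes
  by (auto simp: permutation_permutes finite_union_of_cycles_def pair_fin_digraph_def
      pair_fin_digraph_axioms_def)

text \<open>Out-degree one leaves no choice at any step, so a walk is determined by its start and
  its length.\<close>

lemma awalk_next_vertex:
  assumes "finite_union_of_cycles G" "set p \<subseteq> parcs G" "pcas u p v"
  shows "p = map (\<lambda>i. ((next_vertex G ^^ i) u, (next_vertex G ^^ Suc i) u)) [0..<length p]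
    \<and> v = (next_vertex G ^^ length p) u
    \<and> pawalk_verts u p = map (\<lambda>i. (next_vertex G ^^ i) u) [0..<Suc (length p)]"
  using assms(2,3)
proof (induction p arbitrary: u)
  case Nil
  then show ?case by simp
next
  case (Cons e p)
  let ?f = "next_vertex G"
  have e: "e = (u, ?f u)"
    using Cons.prems parcs_iff_next_vertex[OF assms(1), of u "snd e"] by (cases e) auto
  with Cons have IH: "p = map (\<lambda>i. ((?f ^^ i) (?f u), (?f ^^ Suc i) (?f u))) [0..<length p]"
    "v = (?f ^^ length p) (?f u)"
    "pawalk_verts (?f u) p = map (\<lambda>i. (?f ^^ i) (?f u)) [0..<Suc (length p)]"
    by auto
  have 1: "map (\<lambda>i. ((?f ^^ i) u, (?f ^^ Suc i) u)) [0..<Suc (length p)] = e # p"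
    unfolding map_upt_Suc by (subst (2) IH(1)) (simp add: e funpow_swap1)
  have 2: "map (\<lambda>i. (?f ^^ i) u) [0..<Suc (Suc (length p))] = pawalk_verts u (e # p)"
    unfolding map_upt_Suc[of _ "Suc (length p)"] using IH(3) by (simp add: e funpow_swap1)
  show ?case
    using 1 2 IH(2) by (simp add: funpow_swap1 del: upt_Suc)
qed

text \<open>A closed walk from \<open>u\<close> has a length divisible by the least power fixing
  \<open>u\<close>, and distinctness of its vertices forces equality. Conversely, the orbit of
  \<open>u\<close> is closed under successors and predecessors, so no connected subgraph containing
  it can leave it.\<close>

lemma cycle_lengths_eq:
  assumes "finite_union_of_cycles G"
  shows "cycle_lengths G = least_power (next_vertex G) ` pverts G"
proof (intro equalityI subsetI)
  interpret pair_fin_digraph G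
    using assms by (simp add: finite_union_of_cycles_def)
  let ?f = "next_vertex G"
  note perm = permutation_next_vertex[OF assms]
  fix a assume "a \<in> cycle_lengths G"
  then obtain p u where p: "a = length p" "pre_digraph.awalk (with_proj G) u p u"
    "distinct (tl (pawalk_verts u p))" "p \<noteq> []"
    by (auto simp: cycle_lengths_def cycle_def)
  then have u: "u \<in> pverts G" and "set p \<subseteq> parcs G" "pcas u p u"
    by (auto simp: awalk_def)
  note w = awalk_next_vertex[OF assms this(2,3)]
  have "tl (pawalk_verts u p) = map (\<lambda>i. (?f ^^ Suc i) u) [0..<a]"
    using w p(1) unfolding map_upt_Suc by simp
  then have inj: "inj_on (\<lambda>i. (?f ^^ Suc i) u) {0..<a}"
    using p(3) by (simp add: distinct_map)
  let ?l = "least_power ?f u"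
  have "?l dvd a" using w p(1) least_power_dvd[OF perm] by metis
  moreover have "a > 0" using p by auto
  ultimately have "?l > 0" "?l \<le> a" using least_power_of_permutation(2)[OF perm] by (auto dest: dvd_imp_le)
  \<comment> \<open>Since \<open>tl\<close> drops the start vertex, the visits to \<open>u\<close>
    after \<open>?l\<close> and after \<open>a\<close> steps have the indices \<open>?l - 1\<close>
    and \<open>a - 1\<close>.\<close>
  moreover have "(?f ^^ Suc (?l - 1)) u = (?f ^^ Suc (a - 1)) u"
    using w p(1) \<open>?l > 0\<close> \<open>a > 0\<close> least_power_of_permutation(1)[OF perm] by simp
  then have "?l - 1 = a - 1"
    using \<open>?l > 0\<close> \<open>?l \<le> a\<close> by (intro inj_onD[OF inj]) auto
  ultimately have "a = ?l" using \<open>a > 0\<close> by linarith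
  then show "a \<in> least_power ?f ` pverts G" using u by blast
next
  interpret pair_fin_digraph G
    using assms by (simp add: finite_union_of_cycles_def)
  let ?f = "next_vertex G"
  note perm = permutation_next_vertex[OF assms] and iff = parcs_iff_next_vertex[OF assms]
  fix a assume "a \<in> least_power ?f ` pverts G"
  then obtain u where u: "u \<in> pverts G" and a: "a = least_power ?f u" by auto
  have a0: "a > 0" and fa: "(?f ^^ a) u = u"
    using least_power_of_permutation[OF perm] by (auto simp: a)
  have V: "(?f ^^ i) u \<in> pverts G" for i
    using permutes_in_image[OF permutes_funpow[OF next_vertex_permutes[OF assms]]] u by blast
  define p where "p n = map (\<lambda>i. ((?f ^^ i) u, (?f ^^ Suc i) u)) [0..<n]" for n
  have cas: "pcas u (p n) ((?f ^^ n) u)" for n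
  proof (induction n)
    case (Suc n)
    have "pcas x q y \<Longrightarrow> pcas x (q @ [(y, z)]) z" for x y z and q :: "('a \<times> 'a) list"
      by (induction q arbitrary: x) auto
    with Suc show ?case by (simp add: p_def)
  qed (simp add: p_def)
  have setp: "set (p a) = {(x, ?f x) |x. x \<in> (\<lambda>i. (?f ^^ i) u) ` {..<a}}"
    by (auto simp: p_def)
  have "set (p a) \<subseteq> parcs G" using V by (auto simp: iff setp)
  have cyc: "pre_digraph.cycle (with_proj G) (p a)"
  proof -
    have "awalk u (p a) u"
      using u cas[of a] \<open>set (p a) \<subseteq> parcs G\<close> by (simp add: awalk_def fa)
    moreover have "distinct (tl (pawalk_verts u (p a)))"
    proof -
      have "pawalk_verts u (p a) = map (\<lambda>i. (?f ^^ i) u) [0..<Suc a]"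
        using awalk_next_vertex[OF assms \<open>set (p a) \<subseteq> parcs G\<close> cas] by (simp add: p_def)
      then have "tl (pawalk_verts u (p a)) = map ?f (support ?f u)"
        unfolding map_upt_Suc by (simp add: a)
      moreover have "inj ?f" using permutes_inj[OF next_vertex_permutes[OF assms]] .
      ultimately show ?thesis
        using cycle_of_permutation[OF perm, of u] 
        by (simp add: distinct_map comp_inj_on inj_on_subset)
    qed
    moreover have "p a \<noteq> []" using a0 by (simp add: p_def)
    ultimately show ?thesis by (auto simp: cycle_def)
  qed
  define X where "X = (\<lambda>i. (?f ^^ i) u) ` {..<a}"
  have uX: "u \<in> X" using a0 by (auto simp: X_def intro: image_eqI[of _ _ 0])
  have X: "X \<subseteq> pverts G" using V by (auto simp: X_def)
  have fX: "?f x \<in> X \<longleftrightarrow> x \<in> X" for x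
  proof
    assume "x \<in> X"
    then obtain i where i: "i < a" "x = (?f ^^ i) u" by (auto simp: X_def)
    then show "?f x \<in> X"
      using fa uX by (cases "Suc i = a") (auto simp: X_def intro: image_eqI[of _ _ "Suc i"])
  next
    assume "?f x \<in> X"
    then obtain i where i: "i < a" "?f x = (?f ^^ i) u" by (auto simp: X_def)
    \<comment> \<open>The index of the predecessor, counted modulo \<open>a\<close>.\<close>
    define j where "j = (if i = 0 then a - 1 else i - 1)"
    have "?f ((?f ^^ j) u) = (?f ^^ Suc j) u" by simp
    also have "\<dots> = ?f x" using i fa a0 by (cases "i = 0") (simp_all add: j_def del: funpow.simps)
    finally have "?f x = ?f ((?f ^^ j) u)" "j < a"
      using i a0 by (auto simp: j_def)
    then show "x \<in> X"
      using permutes_inj[OF next_vertex_permutes[OF assms]] by (auto simp: X_def dest: injD)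
  qed
  define H where "H = with_proj \<lparr>pverts = X, parcs = set (p a)\<rparr>"
  have wfH: "wf_digraph H"
    using fX by (auto simp: H_def setp X_def[symmetric] wf_digraph_def)
  have sub: "subgraph H (with_proj G)"
    using X \<open>set (p a) \<subseteq> parcs G\<close> wfH wf_digraph_axioms
    by (auto simp: subgraph_def H_def compatible_def)
  have symH: "parcs (mk_symmetric H) = (\<Union>x\<in>X. {(x, ?f x), (?f x, x)})"
    unfolding mk_symmetric_def by (auto simp: H_def setp X_def[symmetric])
  have conn: "connected H"
  proof -
    interpret M: pair_wf_digraph "mk_symmetric H"
      by (rule wf_digraph.wellformed_mk_symmetric[OF wfH])
    have VM: "verts H = X" by (simp add: H_def)
    have 1: "u \<rightarrow>\<^sup>*\<^bsub>with_proj (mk_symmetric H)\<^esub> (?f ^^ i) u" if "i < a" for i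
      using that
    proof (induction i)
      case 0
      then show ?case using VM uX by simp
    next
      case (Suc i)
      then have "(?f ^^ i) u \<in> X" by (auto simp: X_def)
      then have "((?f ^^ i) u, (?f ^^ Suc i) u) \<in> parcs (mk_symmetric H)"
        by (auto simp: symH)
      then show ?case
        using Suc.IH Suc.prems M.reachable_adj_trans by simp
    qed
    have sym: "symmetric (with_proj (mk_symmetric H))"
      by (auto simp: symmetric_def symH sym_def)
    have "u \<rightarrow>\<^sup>*\<^bsub>with_proj (mk_symmetric H)\<^esub> x" if "x \<in> X" for x
      using that 1 by (auto simp: X_def)
    then have "x \<rightarrow>\<^sup>*\<^bsub>with_proj (mk_symmetric H)\<^esub> y" if "x \<in> X" "y \<in> X" for x y
      using that symmetric_reachable[OF sym, of u x] M.reachable_trans by blast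
    moreover have "X \<noteq> {}" using a0 by (auto simp: X_def)
    ultimately show ?thesis by (simp add: connected_def strongly_connected_def VM)
  qed
  have "H' = H" if H': "subgraph H H'" "subgraph H' (with_proj G)" "connected H'" for H'
  proof -
    have th: "tail H' = fst" "head H' = snd" and sub': "verts H' \<subseteq> pverts G" "arcs H' \<subseteq> parcs G"
      and wfH': "wf_digraph H'" and "X \<subseteq> verts H'" "set (p a) \<subseteq> arcs H'"
      using H'(1,2) by (auto simp: subgraph_def compatible_def H_def)
    have symH': "parcs (mk_symmetric H') = (\<Union>(x, y)\<in>arcs H'. {(x, y), (y, x)})"
      unfolding mk_symmetric_def by (auto simp: th)
    interpret M': pair_wf_digraph "mk_symmetric H'"
      by (rule wf_digraph.wellformed_mk_symmetric[OF wfH'])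
    have "verts H' \<subseteq> X"
    proof
      fix v assume "v \<in> verts H'"
      then have "u \<rightarrow>\<^sup>*\<^bsub>with_proj (mk_symmetric H')\<^esub> v"
        using H'(3) uX \<open>X \<subseteq> verts H'\<close>
        by (auto simp: connected_def strongly_connected_def mk_symmetric_def)
      then show "v \<in> X"
      \<comment> \<open>An arc of \<open>H'\<close>, followed in either direction, cannot leave
        \<open>X\<close>, by \<open>fX\<close>.\<close>
      proof (rule M'.reachable_induct)
        show "u \<in> X" by (rule uX)
      next
        fix x y
        assume step: "(x, y) \<in> parcs (mk_symmetric H')" "x \<in> X"
        then have "(x, y) \<in> parcs G \<or> (y, x) \<in> parcs G"
          using sub' by (auto simp: symH')
        then show "y \<in> X" using step(2) fX[of x] fX[of y] by (auto simp: iff)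
      qed
    qed
    then have "verts H' = X" using \<open>X \<subseteq> verts H'\<close> by simp
    moreover have "arcs H' = set (p a)"
    proof (intro equalityI \<open>set (p a) \<subseteq> arcs H'\<close> subsetI)
      fix e assume e: "e \<in> arcs H'"
      then have "fst e \<in> X" using wf_digraph.tail_in_verts[OF wfH' e] \<open>verts H' = X\<close> by (simp add: th)
      moreover have "e \<in> parcs G" using e sub' by auto
      then have "e = (fst e, ?f (fst e))" using iff[of "fst e" "snd e"] by (cases e) auto
      ultimately show "e \<in> set (p a)" unfolding setp X_def by blast
    qed
    ultimately show ?thesis
      using th by (auto simp: H_def with_proj_def intro: pre_digraph.equality)
  qed
  then have "pre_digraph.max_subgraph (with_proj G) connected H"
    using sub conn by (auto simp: max_subgraph_def)
  moreover have "arcs H = set (p a)" "length (p a) = a" by (simp_all add: H_def p_def)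
  ultimately show "a \<in> cycle_lengths G"
    unfolding cycle_lengths_def using cyc by (auto intro!: exI[of _ "p a"] exI[of _ H])
qed

lemma funpow_next_vertex_in:
  assumes "finite_union_of_cycles G" "v \<in> pverts G"
  shows "(next_vertex G ^^ i) v \<in> pverts G"
  using permutes_in_image[OF permutes_funpow[OF next_vertex_permutes[OF assms(1)]]] assms(2) by blast

lemma funpow_next_vertex_id:
  assumes "finite_union_of_cycles G"
  obtains N where "N > 0" "next_vertex G ^^ N = id"
  using permutation_is_nilpotent[OF permutation_next_vertex[OF assms]] by metis

section \<open>Equivariant maps\<close>

text \<open>The commuting maps \<open>T\<close> and \<open>S\<close> act on \<open>X\<close> by
  pairs of exponents. Pick one representative per orbit, send it to a point that all its return
  exponents fix, and extend by letting \<open>T\<close> act as \<open>g\<close> and \<open>S\<close>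
  trivially. The assumption \<open>stab\<close> is exactly what makes this well defined.\<close>

lemma equivariant_map_exists:
  fixes T S :: "'x \<Rightarrow> 'x" and g :: "'y \<Rightarrow> 'y"
  assumes TX: "T \<in> X \<rightarrow> X" and SX: "S \<in> X \<rightarrow> X" and gY: "g \<in> Y \<rightarrow> Y"
    and TS: "\<And>x. x \<in> X \<Longrightarrow> T (S x) = S (T x)"
    and M: "M > 0" "\<And>x. x \<in> X \<Longrightarrow> (T ^^ M) x = x"
    and N: "N > 0" "\<And>x. x \<in> X \<Longrightarrow> (S ^^ N) x = x"
    and stab: "\<And>x. x \<in> X \<Longrightarrow> \<exists>y\<in>Y. \<forall>i j. (T ^^ i) ((S ^^ j) x) = x \<longrightarrow> (g ^^ i) y = y"
  obtains u where "u \<in> X \<rightarrow> Y" "\<And>x. x \<in> X \<Longrightarrow> u (T x) = g (u x)"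
    "\<And>x. x \<in> X \<Longrightarrow> u (S x) = u x"
proof -
  have Ti: "(T ^^ i) x \<in> X" and Si: "(S ^^ i) x \<in> X" and gi: "y \<in> Y \<Longrightarrow> (g ^^ i) y \<in> Y"
    if "x \<in> X" for x y i
    using that TX SX gY by (induction i) auto
  have comm1: "T ((S ^^ j) x) = (S ^^ j) (T x)" if "x \<in> X" for x j
    using that TS Si by (induction j) auto
  have comm: "(T ^^ i) ((S ^^ j) x) = (S ^^ j) ((T ^^ i) x)" if "x \<in> X" for x i j
    using that comm1 Ti by (induction i) auto
  define act where "act i j x = (T ^^ i) ((S ^^ j) x)" for i j x
  have actX: "act i j x \<in> X" if "x \<in> X" for i j x
    using that Ti Si by (simp add: act_def)
  have act_act: "act i j (act i' j' x) = act (i + i') (j + j') x" if "x \<in> X" for i j i' j' x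
    using that Ti Si by (simp add: act_def comm funpow_add)
  have TM: "(T ^^ (M * i)) x = x" and SN: "(S ^^ (N * i)) x = x" if "x \<in> X" for x i
    using that M N by (induction i) (simp_all add: funpow_add)
  have act_period: "act (M * i) (N * j) x = x" if "x \<in> X" for x i j
    using that TM SN by (simp add: act_def)
  define orb where "orb x = {act i j x |i j. True}" for x
  \<comment> \<open>The periods provide inverses: \<open>M * i - i\<close> is a natural number that
    stands for the exponent \<open>-i\<close>.\<close>
  have inverse: "act (M * i - i) (N * j - j) (act i j x) = x" if "x \<in> X" for x i j
    using that act_period M(1) N(1) by (simp add: act_act)
  have orb_act: "orb (act i j x) = orb x" if x: "x \<in> X" for x i j
  proof (intro equalityI subsetI)
    fix z assume "z \<in> orb (act i j x)"
    then show "z \<in> orb x" using act_act[OF x] by (auto simp: orb_def)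
  next
    fix z assume "z \<in> orb x"
    then obtain k l where "z = act k l (act (M * i - i) (N * j - j) (act i j x))"
      using inverse[OF x] by (auto simp: orb_def)
    then show "z \<in> orb (act i j x)"
      unfolding act_act[OF actX[OF x]] by (auto simp: orb_def)
  qed
  \<comment> \<open>The choice depends only on the orbit as a set, so all its points get the same
    representative.\<close>
  define rep where "rep x = (SOME z. z \<in> orb x)" for x
  have self: "x \<in> orb x" for x
    by (auto simp: orb_def act_def intro!: exI[of _ 0])
  have rep_act: "rep (act i j x) = rep x" if "x \<in> X" for x i j
    using orb_act[OF that] by (simp add: rep_def)
  have rep_in: "rep x \<in> orb x" for x
    unfolding rep_def using self by (rule someI)
  have repX: "rep x \<in> X" if "x \<in> X" for x
    using rep_in[of x] actX[OF that] by (auto simp: orb_def)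
  have "\<exists>i j. x = act i j (rep x)" if "x \<in> X" for x
    using rep_in[of x] inverse[OF that] by (auto simp: orb_def) metis
  then obtain I J where IJ: "\<And>x. x \<in> X \<Longrightarrow> x = act (I x) (J x) (rep x)"
    by metis
  obtain y where yY: "\<And>x. x \<in> X \<Longrightarrow> y x \<in> Y"
    and y: "\<And>x i j. x \<in> X \<Longrightarrow> act i j x = x \<Longrightarrow> (g ^^ i) (y x) = y x"
    using stab unfolding act_def by metis
  define u where "u x = (g ^^ I x) (y (rep x))" for x
  have u_eq: "u x = (g ^^ i) (y (rep x))" if x: "x \<in> X" "x = act i j (rep x)" for x i j
  proof -
    let ?r = "rep x" and ?k = "M * i - i"
    have r: "?r \<in> X" by (rule repX[OF x(1)])
    \<comment> \<open>Two ways of reaching \<open>x\<close> from its representative differ by a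
      return to the representative, and \<open>y ?r\<close> is fixed by the power of
      \<open>g\<close> belonging to that return.\<close>
    have "act (?k + I x) (N * j - j + J x) ?r = act ?k (N * j - j) (act i j ?r)"
      using act_act[OF r] IJ[OF x(1)] x(2) by metis
    then have "(g ^^ (?k + I x)) (y ?r) = y ?r"
      using y[OF r] inverse[OF r] by simp
    moreover have "(g ^^ (M * i)) (y ?r) = y ?r"
      using y[OF r, of "M * i" 0] act_period[OF r, of i 0] by simp
    moreover have "i \<le> M * i" using M(1) by simp
    then have "i + (?k + I x) = I x + M * i" by linarith
    then have "(g ^^ i) ((g ^^ (?k + I x)) (y ?r)) = (g ^^ I x) ((g ^^ (M * i)) (y ?r))"
      by (simp only: funpow_add[symmetric, THEN fun_cong, unfolded comp_def])
    ultimately have "(g ^^ I x) (y ?r) = (g ^^ i) (y ?r)"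
      by simp
    then show ?thesis by (simp add: u_def)
  qed
  have u_act: "u (act i j x) = (g ^^ i) (u x)" if x: "x \<in> X" for x i j
  proof -
    have "act i j x = act (i + I x) (j + J x) (rep x)"
      using act_act[OF repX[OF x]] IJ[OF x] by metis
    then have "u (act i j x) = (g ^^ (i + I x)) (y (rep x))"
      using u_eq[OF actX[OF x]] rep_act[OF x] by metis
    then show ?thesis by (simp add: u_def funpow_add)
  qed
  show thesis
  proof
    show "u \<in> X \<rightarrow> Y" using yY repX gi by (auto simp: u_def)
    show "u (T x) = g (u x)" if "x \<in> X" for x
      using u_act[OF that, of 1 0] by (simp add: act_def)
    show "u (S x) = u x" if "x \<in> X" for x
      using u_act[OF that, of 0 1] by (simp add: act_def)
  qed
qed

section \<open>Arithmetic of the division-like operation\<close>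

text \<open>After division by the gcd the two cofactors are coprime. In terms of cycles,
  \<open>a \<ominus> c\<close> is the order of the \<open>c\<close>-th power of a cycle of length
  \<open>a\<close>; all later uses of the operation go through this equivalence.\<close>

lemma dotdiv_dvd_iff:
  assumes "a > 0"
  shows "a \<ominus> c dvd k \<longleftrightarrow> a dvd c * k"
proof -
  have g: "gcd a c > 0" using assms by simp
  obtain a' c' where "a = a' * gcd a c" "c = c' * gcd a c" "coprime a' c'"
    using gcd_coprime_exists[of a c] g by auto
  then have "a \<ominus> c = a'" unfolding dotdiv_def using g by (metis nonzero_mult_div_cancel_right less_numeral_extra(3))
  moreover have "a dvd c * k \<longleftrightarrow> a' * gcd a c dvd c' * k * gcd a c"
    using \<open>a = _\<close> \<open>c = _\<close> by (metis mult.commute mult.left_commute)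
  ultimately show ?thesis
    using assms \<open>coprime a' c'\<close> by (simp add: coprime_dvd_mult_right_iff)
qed

lemma dotdiv_pos: "a > 0 \<Longrightarrow> a \<ominus> c > 0"
  by (simp add: dotdiv_def div_greater_zero_iff dvd_imp_le)

text \<open>Among the admissible multiples of \<open>k\<close>, take \<open>c\<close> with the least
  sum of all \<open>a \<ominus> c\<close>. If a prime \<open>q\<close> divides some
  \<open>a \<ominus> c\<close>, then \<open>c * q\<close> has a smaller sum and is therefore not
  admissible: some \<open>b\<close> in \<open>C\<close> divides \<open>c * q\<close> but not
  \<open>c\<close>, which forces \<open>b \<ominus> c = q\<close>.\<close>

lemma exists_multiple_prime_type:
  fixes C :: "nat set"
  assumes "finite C" "\<And>a. a \<in> C \<Longrightarrow> a > 0" "k > 0" "\<And>a. a \<in> C \<Longrightarrow> \<not> a dvd k"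
  obtains c where "c > 0" "k dvd c" "\<forall>m \<in> C \<ominus>\<^sub>s c. \<exists>p \<in> C \<ominus>\<^sub>s c. prime p \<and> p dvd m"
proof -
  define P where "P c \<longleftrightarrow> c > 0 \<and> k dvd c \<and> (\<forall>a\<in>C. \<not> a dvd c)" for c
  have "P k" using assms by (simp add: P_def)
  then obtain c where c: "P c" and least: "\<And>c'. P c' \<Longrightarrow> (\<Sum>a\<in>C. a \<ominus> c) \<le> (\<Sum>a\<in>C. a \<ominus> c')"
    using ex_has_least_nat[of P k "\<lambda>c. \<Sum>a\<in>C. a \<ominus> c"] by blast
  have "\<exists>q \<in> C \<ominus>\<^sub>s c. prime q \<and> q dvd a \<ominus> c" if a: "a \<in> C" for a
  proof -
    have "\<not> a \<ominus> c dvd 1"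
      using dotdiv_dvd_iff[OF assms(2)[OF a], of c 1] a c by (auto simp: P_def)
    then obtain q where q: "prime q" "q dvd a \<ominus> c"
      using prime_factor_nat[of "a \<ominus> c"] by auto
    have dvd: "b \<ominus> (c * q) dvd b \<ominus> c" if "b \<in> C" for b
    proof -
      have "b dvd q * (c * (b \<ominus> c))"
        using dotdiv_dvd_iff[OF assms(2)[OF that], of c "b \<ominus> c"] by simp
      then show ?thesis
        using dotdiv_dvd_iff[OF assms(2)[OF that]] by (simp add: mult_ac)
    qed
    have le: "b \<ominus> (c * q) \<le> b \<ominus> c" if "b \<in> C" for b
      using dvd[OF that] dotdiv_pos[OF assms(2)[OF that]] by (simp add: dvd_imp_le)
    obtain r where r: "a \<ominus> c = q * r" using q(2) by blast
    have "a dvd c * q * r"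
      using dotdiv_dvd_iff[OF assms(2)[OF a], of c "q * r"] r by (simp add: mult.assoc)
    then have "a \<ominus> (c * q) dvd r"
      using dotdiv_dvd_iff[OF assms(2)[OF a]] by simp
    moreover have "r > 0" using r dotdiv_pos[OF assms(2)[OF a], of c] by simp
    moreover have "r < a \<ominus> c" using r \<open>r > 0\<close> prime_gt_1_nat[OF q(1)] by simp
    ultimately have "a \<ominus> (c * q) < a \<ominus> c" by (auto dest: dvd_imp_le)
    then have "(\<Sum>a\<in>C. a \<ominus> (c * q)) < (\<Sum>a\<in>C. a \<ominus> c)"
      using le a assms(1) by (intro sum_strict_mono_ex1) auto
    then have "\<not> P (c * q)" using least[of "c * q"] by (meson leD)
    moreover have "c * q > 0" "k dvd c * q"
      using c q(1) prime_gt_0_nat by (auto simp: P_def)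
    ultimately obtain b where b: "b \<in> C" "b dvd c * q" by (auto simp: P_def)
    then have "b \<ominus> c dvd q" "\<not> b \<ominus> c dvd 1"
      using dotdiv_dvd_iff[OF assms(2)[OF b(1)], of c q]
        dotdiv_dvd_iff[OF assms(2)[OF b(1)], of c 1] b c by (auto simp: P_def)
    then have "b \<ominus> c = q"
      using q(1) by (auto simp: prime_nat_iff)
    then show ?thesis using b(1) q by (auto simp: dotdiv_set_def)
  qed
  then have "\<forall>m \<in> C \<ominus>\<^sub>s c. \<exists>p \<in> C \<ominus>\<^sub>s c. prime p \<and> p dvd m"
    by (auto simp: dotdiv_set_def)
  then show thesis using that c by (auto simp: P_def)
qed

section \<open>Polymorphisms and pp-constructions\<close>

lemma pp_sat_cong:
  assumes "\<And>i. i \<in> pp_fv \<phi> \<Longrightarrow> v i = w i"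
  shows "pp_sat A v \<phi> \<longleftrightarrow> pp_sat A w \<phi>"
  using assms
proof (induction \<phi> arbitrary: v w)
  case (Rel r xs)
  then have "map v xs = map w xs" by simp
  then show ?case by (simp only: pp_sat.simps)
next
  case (And \<phi> \<psi>)
  then show ?case by (metis UnI1 UnI2 pp_fv.simps(4) pp_sat.simps(4))
next
  case (Ex x \<phi>)
  then have "pp_sat A (v(x := a)) \<phi> \<longleftrightarrow> pp_sat A (w(x := a)) \<phi>" for a
    by (intro Ex.IH) auto
  then show ?case by simp
qed simp_all

text \<open>Arguments are extensional functions on an arbitrary index set, so that the vertices of a
  graph can serve as coordinates.\<close>

definition is_polymorphism ::
  "('r, 'a) rel_struct \<Rightarrow> 'i set \<Rightarrow> (('i \<Rightarrow> 'a) \<Rightarrow> 'a) \<Rightarrow> bool" where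
  "is_polymorphism A I f \<longleftrightarrow>
     f \<in> (I \<rightarrow>\<^sub>E dom_of A) \<rightarrow> dom_of A \<and>
     (\<forall>r T. (\<forall>x\<in>I. T x \<in> rel_of A r) \<longrightarrow>
       map (\<lambda>i. f (\<lambda>x\<in>I. T x ! i)) [0..<arity_of A r] \<in> rel_of A r)"

text \<open>Polymorphisms preserve pp formulas: under a quantifier, applying \<open>f\<close> to the
  tuple of witnesses yields a witness. Some index must exist because of \<open>Bot\<close>.\<close>

lemma polymorphism_pp_sat:
  assumes f: "is_polymorphism A I f" and "I \<noteq> {}"
    and "pp_wf (arity_of A) \<phi>" and "\<And>x. x \<in> I \<Longrightarrow> pp_sat A (v x) \<phi>"
  shows "pp_sat A (\<lambda>i. f (\<lambda>x\<in>I. v x i)) \<phi>"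
  using assms(3,4)
proof (induction \<phi> arbitrary: v)
  case (Rel r xs)
  have "map (\<lambda>i. f (\<lambda>x\<in>I. map (v x) xs ! i)) [0..<arity_of A r] \<in> rel_of A r"
    using f Rel.prems by (simp add: is_polymorphism_def)
  also have "map (\<lambda>i. f (\<lambda>x\<in>I. map (v x) xs ! i)) [0..<arity_of A r] = map (\<lambda>i. f (\<lambda>x\<in>I. v x i)) xs"
    using Rel.prems(1) by (intro nth_equalityI) (auto intro!: arg_cong[of _ _ f])
  finally show ?case by (simp only: pp_sat.simps)
next
  case (Eq x y)
  then have "(\<lambda>z\<in>I. v z x) = (\<lambda>z\<in>I. v z y)"
    by (intro restrict_ext) simp
  then show ?case by (simp only: pp_sat.simps)
next
  case Bot
  then show ?case using \<open>I \<noteq> {}\<close> by auto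
next
  case (And \<phi> \<psi>)
  then show ?case by simp
next
  case (Ex y \<phi>)
  then have "\<forall>x\<in>I. \<exists>a\<in>dom_of A. pp_sat A ((v x)(y := a)) \<phi>" by simp
  then obtain a where a: "\<And>x. x \<in> I \<Longrightarrow> a x \<in> dom_of A"
    "\<And>x. x \<in> I \<Longrightarrow> pp_sat A ((v x)(y := a x)) \<phi>"
    by metis
  have "(\<lambda>i. f (\<lambda>x\<in>I. ((v x)(y := a x)) i)) = (\<lambda>i. f (\<lambda>x\<in>I. v x i))(y := f (\<lambda>x\<in>I. a x))"
    by (rule ext) simp
  moreover have "pp_sat A (\<lambda>i. f (\<lambda>x\<in>I. ((v x)(y := a x)) i)) \<phi>"
    by (rule Ex.IH[of "\<lambda>x. (v x)(y := a x)"]) (use Ex.prems(1) a(2) in \<open>simp_all only: pp_wf.simps\<close>)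
  moreover have "restrict a I \<in> I \<rightarrow>\<^sub>E dom_of A"
    using a(1) by simp
  then have "f (\<lambda>x\<in>I. a x) \<in> dom_of A"
    using f unfolding is_polymorphism_def by blast
  ultimately show ?case unfolding pp_sat.simps by metis
qed

lemma polymorphism_pp_definable:
  assumes f: "is_polymorphism A I f" and "I \<noteq> {}"
    and R: "pp_definable A k R" and T: "\<And>x. x \<in> I \<Longrightarrow> T x \<in> R"
  shows "map (\<lambda>i. f (\<lambda>x\<in>I. T x ! i)) [0..<k] \<in> R"
proof -
  obtain \<phi> where \<phi>: "pp_wf (arity_of A) \<phi>" "pp_fv \<phi> \<subseteq> {..<k}"
    and R_eq: "R = {xs \<in> tuples k (dom_of A). pp_sat A (\<lambda>i. xs ! i) \<phi>}"
    using R by (auto simp: pp_definable_def)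
  let ?ys = "map (\<lambda>i. f (\<lambda>x\<in>I. T x ! i)) [0..<k]"
  have "pp_sat A (\<lambda>i. f (\<lambda>x\<in>I. T x ! i)) \<phi>"
    using polymorphism_pp_sat[OF f \<open>I \<noteq> {}\<close> \<phi>(1)] T by (simp add: R_eq)
  \<comment> \<open>List and function agree only below \<open>k\<close>, which suffices because the
    free variables lie there.\<close>
  then have "pp_sat A (\<lambda>i. ?ys ! i) \<phi>"
    using \<phi>(2) by (subst pp_sat_cong[of \<phi> _ "\<lambda>i. f (\<lambda>x\<in>I. T x ! i)"]) auto
  moreover have "f (\<lambda>x\<in>I. T x ! i) \<in> dom_of A" if "i < k" for i
  proof -
    have "T x ! i \<in> dom_of A" if "x \<in> I" for x
      using T[OF that] \<open>i < k\<close> by (auto simp: R_eq tuples_def dest: nth_mem)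
    then show ?thesis using f by (auto simp: is_polymorphism_def)
  qed
  then have "?ys \<in> tuples k (dom_of A)" by (auto simp: tuples_def)
  ultimately show ?thesis by (simp add: R_eq)
qed

lemma is_hom_comp:
  assumes "is_hom A B f" "is_hom B C g"
  shows "is_hom A C (g \<circ> f)"
  using assms unfolding is_hom_def by (auto simp flip: map_map)

lemma hom_equivalent_trans:
  assumes "hom_equivalent A B" "hom_equivalent B C"
  shows "hom_equivalent A C"
  using assms is_hom_comp[of A B _ C] is_hom_comp[of C B _ A] unfolding hom_equivalent_def by blast

lemma isomorphic_imp_hom_equivalent:
  assumes "isomorphic A B" "is_structure A"
  shows "hom_equivalent A B"
proof -
  obtain f where ar: "arity_of A = arity_of B" and f: "bij_betw f (dom_of A) (dom_of B)"
    and rel: "\<And>r. rel_of B r = map f ` rel_of A r"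
    using assms(1) by (auto simp: isomorphic_def)
  let ?g = "the_inv_into (dom_of A) f"
  have inv: "map ?g (map f xs) = xs" if "xs \<in> rel_of A r" for xs r
  proof -
    have "set xs \<subseteq> dom_of A" using that assms(2) by (auto simp: is_structure_def tuples_def)
    then have "map (?g \<circ> f) xs = xs"
      using f by (intro map_idI) (auto simp: bij_betw_def the_inv_into_f_f)
    then show ?thesis by simp
  qed
  have "is_hom B A ?g"
    using bij_betw_imp_funcset[OF bij_betw_the_inv_into[OF f]] ar rel inv
    by (auto simp: is_hom_def simp del: map_map)
  moreover have "is_hom A B f"
    using bij_betw_imp_funcset[OF f] ar rel by (auto simp: is_hom_def)
  ultimately show ?thesis by (auto simp: hom_equivalent_def)
qed

lemma digraph_struct_simps [simp]:
  "dom_of (digraph_struct G) = pverts G"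
  "arity_of (digraph_struct G) r = 2"
  "[x, y] \<in> rel_of (digraph_struct G) r \<longleftrightarrow> (x, y) \<in> parcs G"
  by (auto simp: digraph_struct_def)

text \<open>Coordinatewise application of the polymorphism to a copy of \<open>GC\<close> inside the pp-power gives
  a closed walk of length \<open>c\<close> there, which maps back to \<open>GC\<close>.\<close>

lemma pp_constructs_loop:
  fixes GC :: "'a pair_pre_digraph" and A :: "('r, 'b) rel_struct"
  assumes C: "finite_union_of_cycles GC" and A: "is_structure A"
    and constr: "pp_constructs A (digraph_struct GC)"
    and f: "is_polymorphism A (pverts GC) f"
    and inv: "\<And>t. t \<in> pverts GC \<rightarrow>\<^sub>E dom_of A \<Longrightarrow>
      f (\<lambda>x\<in>pverts GC. t ((next_vertex GC ^^ c) x)) = f t"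
  shows "\<exists>z\<in>pverts GC. (next_vertex GC ^^ c) z = z"
proof -
  let ?V = "pverts GC" and ?d = "next_vertex GC"
  have dV: "(?d ^^ i) x \<in> ?V" if "x \<in> ?V" for i x
    using permutes_in_image[OF permutes_funpow[OF next_vertex_permutes[OF C]]] that by blast
  have "?V \<noteq> {}" using C by (simp add: finite_union_of_cycles_def)
  obtain n and Q :: "(unit, 'b list) rel_struct" and P :: "(unit, 'b list) rel_struct"
    where Q: "is_structure Q" "dom_of Q = tuples n (dom_of A)"
      "\<And>s. pp_definable A (arity_of Q s * n) (concat ` rel_of Q s)" "isomorphic Q P"
      and P: "hom_equivalent P (digraph_struct GC)"
    using constr unfolding pp_constructs_def is_pp_power_def by blast
  obtain u w where u: "is_hom Q (digraph_struct GC) u" and w: "is_hom (digraph_struct GC) Q w"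
    using hom_equivalent_trans[OF isomorphic_imp_hom_equivalent[OF Q(4,1)] P]
    unfolding hom_equivalent_def by blast
  have ar: "arity_of Q s = 2" for s using u by (simp add: is_hom_def)
  have relQ: "rel_of Q s \<subseteq> tuples 2 (tuples n (dom_of A))" for s
    using Q(1,2) by (simp add: is_structure_def ar)
  have wV: "w x \<in> tuples n (dom_of A)" if "x \<in> ?V" for x
    using w that Q(2) by (auto simp: is_hom_def)
  \<comment> \<open>The copy \<open>w\<close> of \<open>GC\<close>, rotated by \<open>i\<close>
    steps, is collapsed by \<open>f\<close> in each of the \<open>n\<close> coordinates.\<close>
  define q where "q i = map (\<lambda>l. f (\<lambda>x\<in>?V. w ((?d ^^ i) x) ! l)) [0..<n]" for i
  have step: "[q i, q (Suc i)] \<in> rel_of Q ()" for i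
  proof -
    \<comment> \<open>One edge of the copy for each index \<open>x\<close>, flattened to a
      \<open>2 * n\<close>-tuple as the pp definition requires.\<close>
    define T where "T x = w ((?d ^^ i) x) @ w ((?d ^^ Suc i) x)" for x
    have "T x \<in> concat ` rel_of Q ()" if "x \<in> ?V" for x
    proof -
      have "[(?d ^^ i) x, (?d ^^ Suc i) x] \<in> rel_of (digraph_struct GC) ()"
        using dV[OF that] by (simp add: parcs_iff_next_vertex[OF C])
      then have "map w [(?d ^^ i) x, (?d ^^ Suc i) x] \<in> rel_of Q ()"
        using w unfolding is_hom_def by blast
      then show ?thesis unfolding T_def by (force intro: image_eqI)
    qed
    then have "map (\<lambda>l. f (\<lambda>x\<in>?V. T x ! l)) [0..<2 * n] \<in> concat ` rel_of Q ()"
      using polymorphism_pp_definable[OF f \<open>?V \<noteq> {}\<close> Q(3)] by (simp add: ar)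
    moreover have "map (\<lambda>l. f (\<lambda>x\<in>?V. T x ! l)) [0..<2 * n] = q i @ q (Suc i)"
    proof (rule nth_equalityI)
      fix l assume "l < length (map (\<lambda>l. f (\<lambda>x\<in>?V. T x ! l)) [0..<2 * n])"
      then have l: "l < 2 * n" by simp
      have len: "length (w ((?d ^^ j) x)) = n" if "x \<in> ?V" for j x
        using wV[OF dV[OF that]] by (simp add: tuples_def)
      show "map (\<lambda>l. f (\<lambda>x\<in>?V. T x ! l)) [0..<2 * n] ! l = (q i @ q (Suc i)) ! l"
        using l len len[of _ "Suc i"] by (auto simp: q_def T_def nth_append intro!: arg_cong[of _ _ f])
    qed (simp add: q_def)
    ultimately obtain ys where ys: "ys \<in> rel_of Q ()" "concat ys = q i @ q (Suc i)"
      by auto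
    \<comment> \<open>The two endpoints can be read off the concatenation because each has length
      \<open>n\<close>.\<close>
    then have "ys \<in> tuples 2 (tuples n (dom_of A))" using relQ by blast
    then obtain y z where "ys = [y, z]" "length y = n"
      by (auto simp: tuples_def numeral_2_eq_2 length_Suc_conv)
    moreover have "length (q i) = n" by (simp add: q_def)
    ultimately show ?thesis using ys by simp
  qed
  have "(u (q i), u (q (Suc i))) \<in> parcs GC" for i
  proof -
    have "map u [q i, q (Suc i)] \<in> rel_of (digraph_struct GC) ()"
      using u step unfolding is_hom_def by blast
    then show ?thesis by simp
  qed
  then have z: "u (q i) \<in> ?V" "u (q (Suc i)) = ?d (u (q i))" for i
    by (auto simp: parcs_iff_next_vertex[OF C])
  have walk: "u (q i) = (?d ^^ i) (u (q 0))" for i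
    by (induction i) (simp_all add: z)
  \<comment> \<open>Rotation by \<open>c\<close> steps is the reindexing under which
    \<open>f\<close> is invariant, so the walk closes.\<close>
  have "q c = q 0"
  proof -
    have "f (\<lambda>x\<in>?V. w ((?d ^^ c) x) ! l) = f (\<lambda>x\<in>?V. w x ! l)" if l: "l < n" for l
    proof -
      have "w x ! l \<in> dom_of A" if "x \<in> ?V" for x
        using wV[OF that] l by (auto simp: tuples_def dest: nth_mem)
      then have "f (\<lambda>x\<in>?V. (\<lambda>x\<in>?V. w x ! l) ((?d ^^ c) x)) = f (\<lambda>x\<in>?V. w x ! l)"
        by (intro inv) auto
      then show ?thesis using dV by (simp cong: restrict_cong)
    qed
    then show ?thesis by (simp add: q_def)
  qed
  then show ?thesis using walk[of c] z(1)[of 0] by metis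
qed

section \<open>Necessity of the lcm condition\<close>

text \<open>The edge relation is the graph of the successor map, so preserving it amounts to
  commuting with that map.\<close>

lemma polymorphism_digraph_structI:
  fixes G :: "'a pair_pre_digraph" and I :: "'i set"
  assumes G: "finite_union_of_cycles G" and f: "f \<in> (I \<rightarrow>\<^sub>E pverts G) \<rightarrow> pverts G"
    and comm: "\<And>t. t \<in> I \<rightarrow>\<^sub>E pverts G \<Longrightarrow> f (\<lambda>x\<in>I. next_vertex G (t x)) = next_vertex G (f t)"
  shows "is_polymorphism (digraph_struct G) I f"
  unfolding is_polymorphism_def
proof (intro conjI allI impI)
  fix r and T :: "'i \<Rightarrow> 'a list" assume T: "\<forall>x\<in>I. T x \<in> rel_of (digraph_struct G) r"
  have T01: "T x ! 0 \<in> pverts G \<and> T x ! 1 = next_vertex G (T x ! 0)" if "x \<in> I" for x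
    using T that by (fastforce simp: digraph_struct_def parcs_iff_next_vertex[OF G])
  let ?t = "\<lambda>x\<in>I. T x ! 0"
  have t: "?t \<in> I \<rightarrow>\<^sub>E pverts G" using T01 by simp
  have "(\<lambda>x\<in>I. next_vertex G (?t x)) = (\<lambda>x\<in>I. T x ! 1)"
    using T01 by (intro restrict_ext) simp
  then have "f (\<lambda>x\<in>I. T x ! 1) = next_vertex G (f ?t)"
    using comm[OF t] by metis
  moreover have "f ?t \<in> pverts G" using f t by blast
  ultimately have "(f ?t, f (\<lambda>x\<in>I. T x ! 1)) \<in> parcs G"
    using parcs_iff_next_vertex[OF G] by blast
  then have "[f ?t, f (\<lambda>x\<in>I. T x ! 1)] \<in> rel_of (digraph_struct G) r"
    by (simp only: digraph_struct_simps)
  moreover have "[0..<2] = [0, 1::nat]" by (simp add: numeral_2_eq_2)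
  ultimately show "map (\<lambda>i. f (\<lambda>x\<in>I. T x ! i)) [0..<arity_of (digraph_struct G) r]
      \<in> rel_of (digraph_struct G) r"
    by (simp only: digraph_struct_simps list.map)
qed (use f in simp)

text \<open>The failure of every \<open>h\<close> is used once per tuple \<open>t\<close>: the map
  \<open>h\<close> read off from \<open>t\<close> fails at some \<open>a\<close>, and a vertex on a
  cycle of length \<open>a\<close> is the fixed point that \<open>equivariant_map_exists\<close>
  asks for.\<close>

lemma pp_constructs_imp_lcm_condition:
  fixes GC :: "'a pair_pre_digraph" and GD :: "'b pair_pre_digraph"
  assumes GC: "finite_union_of_cycles GC" and GD: "finite_union_of_cycles GD"
    and C: "C = cycle_lengths GC" and D: "D = cycle_lengths GD"
    and constr: "pp_constructs (digraph_struct GD) (digraph_struct GC)"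
    and prime_type: "\<forall>m \<in> C \<ominus>\<^sub>s c. \<exists>p \<in> C \<ominus>\<^sub>s c. prime p \<and> p dvd m"
  shows "\<exists>h :: nat \<Rightarrow> nat. h \<in> (C \<ominus>\<^sub>s c) \<rightarrow> D \<and>
    (\<forall>a \<in> D. \<not> a dvd Lcm {h b \<ominus> b |b. b \<in> C \<ominus>\<^sub>s c})"
proof (rule ccontr)
  assume contra: "\<nexists>h :: nat \<Rightarrow> nat. h \<in> (C \<ominus>\<^sub>s c) \<rightarrow> D \<and>
    (\<forall>a \<in> D. \<not> a dvd Lcm {h b \<ominus> b |b. b \<in> C \<ominus>\<^sub>s c})"
  let ?V = "pverts GC" and ?W = "pverts GD" and ?d = "next_vertex GC" and ?e = "next_vertex GD"
  note permC = permutation_next_vertex[OF GC] and permD = permutation_next_vertex[OF GD]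
  define X where "X = ?V \<rightarrow>\<^sub>E ?W"
  define T where "T t = (\<lambda>x\<in>?V. ?e (t x))" for t
  define S where "S t = (\<lambda>x\<in>?V. t ((?d ^^ c) x))" for t :: "'a \<Rightarrow> 'b"
  have dV: "(?d ^^ i) x \<in> ?V" if "x \<in> ?V" for x i
    by (rule funpow_next_vertex_in[OF GC that])
  have eW: "(?e ^^ i) y \<in> ?W" if "y \<in> ?W" for y i
    by (rule funpow_next_vertex_in[OF GD that])
  have TX: "T t \<in> X" and SX: "S t \<in> X" if "t \<in> X" for t
    using that dV eW[of _ 1] by (auto simp: T_def S_def X_def)
  have Ti: "(T ^^ i) t = (\<lambda>x\<in>?V. (?e ^^ i) (t x))" if "t \<in> X" for t i
    by (induction i) (use that in \<open>auto simp: T_def X_def fun_eq_iff restrict_def PiE_iff extensional_def\<close>)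
  have Sj: "(S ^^ j) t = (\<lambda>x\<in>?V. t ((?d ^^ (c * j)) x))" if "t \<in> X" for t j
  proof (induction j)
    case 0
    then show ?case using that by (auto simp: X_def fun_eq_iff restrict_def PiE_iff extensional_def)
  next
    case (Suc j)
    then show ?case
      using dV by (auto simp: S_def fun_eq_iff funpow_add add.commute[of c])
  qed
  obtain M N where M: "M > 0" "?e ^^ M = id" and N: "N > 0" "?d ^^ N = id"
    using funpow_next_vertex_id[OF GC] funpow_next_vertex_id[OF GD] by metis
  have "\<forall>b\<in>C \<ominus>\<^sub>s c. \<exists>x\<in>?V. b = least_power ?d x \<ominus> c"
    by (auto simp: C cycle_lengths_eq[OF GC] dotdiv_set_def)
  \<comment> \<open>For each \<open>b\<close>, a vertex on a cycle of \<open>GC\<close> whose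
    \<open>c\<close>-th power has order \<open>b\<close>.\<close>
  then obtain r where r: "\<And>b. b \<in> C \<ominus>\<^sub>s c \<Longrightarrow> r b \<in> ?V"
    "\<And>b. b \<in> C \<ominus>\<^sub>s c \<Longrightarrow> b = least_power ?d (r b) \<ominus> c"
    by metis
  have stab: "\<exists>y\<in>?W. \<forall>i j. (T ^^ i) ((S ^^ j) t) = t \<longrightarrow> (?e ^^ i) y = y" if t: "t \<in> X" for t
  proof -
    define h where "h b = least_power ?e (t (r b))" for b
    have "h \<in> (C \<ominus>\<^sub>s c) \<rightarrow> D"
    proof
      fix b assume "b \<in> C \<ominus>\<^sub>s c"
      then have "t (r b) \<in> ?W" using r(1) t by (auto simp: X_def)
      then show "h b \<in> D" by (simp add: h_def D cycle_lengths_eq[OF GD])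
    qed
    then obtain a where a: "a \<in> D" "a dvd Lcm {h b \<ominus> b |b. b \<in> C \<ominus>\<^sub>s c}"
      using contra by blast
    then obtain y where y: "y \<in> ?W" "a = least_power ?e y"
      by (auto simp: D cycle_lengths_eq[OF GD])
    have "(?e ^^ i) y = y" if ij: "(T ^^ i) ((S ^^ j) t) = t" for i j
    proof -
      have "(S ^^ j) t \<in> X" using t SX by (induction j) auto
      then have step: "t x = (?e ^^ i) (t ((?d ^^ (c * j)) x))" if "x \<in> ?V" for x
        using fun_cong[OF ij, of x] that by (simp add: Ti Sj[OF t])
      have iter: "t x = (?e ^^ (k * i)) (t ((?d ^^ (c * j * k)) x))" if "x \<in> ?V" for x k
      proof (induction k)
        case (Suc k)
        have "t ((?d ^^ (c * j * k)) x) = (?e ^^ i) (t ((?d ^^ (c * j * Suc k)) x))"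
          using step[OF dV[OF that]] by (simp add: funpow_add)
        then show ?case using Suc by (simp add: funpow_add add.commute[of i])
      qed simp
      have "h b \<ominus> b dvd i" if b: "b \<in> C \<ominus>\<^sub>s c" for b
      proof -
        \<comment> \<open>After \<open>b\<close> rounds the reindexing returns to
          \<open>r b\<close>, while \<open>t (r b)\<close> has been moved by \<open>b * i\<close>
          steps along its cycle of length \<open>h b\<close>.\<close>
        have "least_power ?d (r b) dvd c * b"
          using r(2)[OF b] dotdiv_dvd_iff[of "least_power ?d (r b)" c b]
            least_power_of_permutation(2)[OF permC] by simp
        then have "least_power ?d (r b) dvd c * j * b"
          by (metis dvd_mult2 mult.assoc mult.commute)
        then have "(?d ^^ (c * j * b)) (r b) = r b"
          using least_power_dvd[OF permC] by blast
        then have "(?e ^^ (b * i)) (t (r b)) = t (r b)"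
          using iter[OF r(1)[OF b], of b] by simp
        then have "h b dvd b * i"
          using least_power_dvd[OF permD] by (simp add: h_def)
        then show ?thesis
          using dotdiv_dvd_iff[of "h b" b i] least_power_of_permutation(2)[OF permD]
          by (simp add: h_def)
      qed
      then have "Lcm {h b \<ominus> b |b. b \<in> C \<ominus>\<^sub>s c} dvd i"
        by (intro Lcm_least) auto
      then show ?thesis
        using a(2) y(2) least_power_dvd[OF permD] dvd_trans by blast
    qed
    then show ?thesis using y(1) by blast
  qed
  obtain f where f: "f \<in> X \<rightarrow> ?W" "\<And>t. t \<in> X \<Longrightarrow> f (T t) = ?e (f t)"
    "\<And>t. t \<in> X \<Longrightarrow> f (S t) = f t"
  proof (rule equivariant_map_exists[of T X S ?e ?W M "N"])
    show "T (S t) = S (T t)" for t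
      using dV by (auto simp: T_def S_def fun_eq_iff)
    show "(T ^^ M) t = t" if "t \<in> X" for t
      unfolding Ti[OF that] using that M(2) by (simp add: X_def)
    show "(S ^^ N) t = t" if "t \<in> X" for t
    proof -
      have "?d ^^ (c * N) = id" using N(2) by (metis funpow_mult id_funpow mult.commute)
      then show ?thesis unfolding Sj[OF that] using that by (simp add: X_def)
    qed
  qed (use TX SX eW[of _ 1] M(1) N(1) stab in auto)
  have "is_polymorphism (digraph_struct GD) ?V f"
    using f(1,2) by (intro polymorphism_digraph_structI[OF GD]) (auto simp: X_def T_def)
  then obtain z where z: "z \<in> ?V" "(?d ^^ c) z = z"
    using pp_constructs_loop[OF GC is_structure_digraph_struct[OF GD] constr, of f c] f(3)
    by (auto simp: X_def S_def)
  have "least_power ?d z \<in> C" using z(1) by (auto simp: C cycle_lengths_eq[OF GC])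
  moreover have "least_power ?d z \<ominus> c dvd 1"
    using z(2) dotdiv_dvd_iff[of _ c 1] least_power_dvd[OF permC]
      least_power_of_permutation(2)[OF permC] by simp
  ultimately have "1 \<in> C \<ominus>\<^sub>s c" by (force simp: dotdiv_set_def)
  \<comment> \<open>No prime divides 1.\<close>
  then show False using prime_type by (auto dest!: bspec[of _ _ 1])
qed

section \<open>The pp-power of polymorphisms\<close>

lemma foldr_And_simps [simp]:
  "pp_sat A v (foldr And \<phi>s \<psi>) \<longleftrightarrow> (\<forall>\<phi>\<in>set \<phi>s. pp_sat A v \<phi>) \<and> pp_sat A v \<psi>"
  "pp_wf ar (foldr And \<phi>s \<psi>) \<longleftrightarrow> (\<forall>\<phi>\<in>set \<phi>s. pp_wf ar \<phi>) \<and> pp_wf ar \<psi>"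
  "pp_fv (foldr And \<phi>s \<psi>) = (\<Union>\<phi>\<in>set \<phi>s. pp_fv \<phi>) \<union> pp_fv \<psi>"
  by (induction \<phi>s) auto

text \<open>With \<open>\<tau> i\<close> and \<open>\<rho> i\<close> the positions of the tuples obtained from the \<open>i\<close>-th tuple by moving
  along \<open>GD\<close> and along \<open>GC\<close>, the relation consists of the pairs \<open>(f, f(\<cdot> \<circ> \<rho>))\<close> with \<open>f\<close> a
  polymorphism.\<close>

lemma pp_definable_polymorphism_shift:
  assumes "N > 0" and \<tau>: "\<And>i. i < N \<Longrightarrow> \<tau> i < N" and \<rho>: "\<And>i. i < N \<Longrightarrow> \<rho> i < N"
  shows "pp_definable (digraph_struct G) (2 * N)
    {xs @ map (\<lambda>i. xs ! \<rho> i) [0..<N] |xs.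
      xs \<in> tuples N (pverts G) \<and> (\<forall>i<N. (xs ! i, xs ! \<tau> i) \<in> parcs G)}"
    (is "pp_definable _ _ ?R")
proof -
  \<comment> \<open>Variables below \<open>N\<close> hold the values of a function, the next
    \<open>N\<close> those of its reindexing. \<open>Eq 0 0\<close> serves as the true formula
    ending the conjunction.\<close>
  define \<phi> where "\<phi> = foldr And (map (\<lambda>i. Rel () [i, \<tau> i]) [0..<N] @
    map (\<lambda>i. Eq (N + i) (\<rho> i)) [0..<N]) (Eq 0 0)"
  have sat: "pp_sat (digraph_struct G) v \<phi> \<longleftrightarrow>
    (\<forall>i<N. (v i, v (\<tau> i)) \<in> parcs G) \<and> (\<forall>i<N. v (N + i) = v (\<rho> i))" for v
    by (auto simp: \<phi>_def)
  have "?R = {zs \<in> tuples (2 * N) (pverts G). pp_sat (digraph_struct G) (\<lambda>i. zs ! i) \<phi>}"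
  proof (intro equalityI subsetI)
    fix zs assume "zs \<in> ?R"
    then obtain xs where "zs = xs @ map (\<lambda>i. xs ! \<rho> i) [0..<N]"
      "set xs \<subseteq> pverts G" "length xs = N" "\<forall>i<N. (xs ! i, xs ! \<tau> i) \<in> parcs G"
      by (auto simp: tuples_def)
    then show "zs \<in> {zs \<in> tuples (2 * N) (pverts G). pp_sat (digraph_struct G) (\<lambda>i. zs ! i) \<phi>}"
      using \<tau> \<rho> unfolding sat by (auto simp: tuples_def nth_append subset_iff)
  next
    fix zs assume "zs \<in> {zs \<in> tuples (2 * N) (pverts G). pp_sat (digraph_struct G) (\<lambda>i. zs ! i) \<phi>}"
    then have zs: "set zs \<subseteq> pverts G" "length zs = 2 * N"
      "\<forall>i<N. (zs ! i, zs ! \<tau> i) \<in> parcs G" "\<forall>i<N. zs ! (N + i) = zs ! \<rho> i"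
      unfolding sat by (auto simp: tuples_def)
    have "zs = take N zs @ map (\<lambda>i. take N zs ! \<rho> i) [0..<N]"
      using zs(2,4) \<rho> by (auto simp: nth_append intro!: nth_equalityI)
        (metis add_diff_inverse_nat add_less_cancel_left mult_2)
    moreover have "take N zs \<in> tuples N (pverts G)"
      using zs(1,2) set_take_subset[of N zs] by (auto simp: tuples_def)
    ultimately show "zs \<in> ?R" using zs(3) \<tau> by (intro CollectI exI[of _ "take N zs"]) auto
  qed
  moreover have "pp_wf (arity_of (digraph_struct G)) \<phi>" by (auto simp: \<phi>_def)
  moreover have "pp_fv \<phi> \<subseteq> {..<2 * N}"
    using \<open>N > 0\<close> \<tau> \<rho> by (force simp: \<phi>_def)
  ultimately show ?thesis unfolding pp_definable_def by auto
qed

section \<open>Sufficiency of the lcm condition\<close>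

lemma lcm_condition_imp_pp_constructs:
  fixes GC :: "'a pair_pre_digraph" and GD :: "'b pair_pre_digraph"
  assumes GC: "finite_union_of_cycles GC" and GD: "finite_union_of_cycles GD"
    and C: "C = cycle_lengths GC" and D: "D = cycle_lengths GD"
    and cond: "\<And>c. c > 0 \<Longrightarrow> \<forall>m \<in> C \<ominus>\<^sub>s c. \<exists>p \<in> C \<ominus>\<^sub>s c. prime p \<and> p dvd m \<Longrightarrow>
      \<exists>h :: nat \<Rightarrow> nat. h \<in> (C \<ominus>\<^sub>s c) \<rightarrow> D \<and>
        (\<forall>a \<in> D. \<not> a dvd Lcm {h b \<ominus> b |b. b \<in> C \<ominus>\<^sub>s c})"
  shows "pp_constructs (digraph_struct GD) (digraph_struct GC)"
proof -
  let ?V = "pverts GC" and ?W = "pverts GD" and ?d = "next_vertex GC" and ?e = "next_vertex GD"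
  note permC = permutation_next_vertex[OF GC] and permD = permutation_next_vertex[OF GD]
  have dV: "(?d ^^ i) x \<in> ?V" if "x \<in> ?V" for x i
    by (rule funpow_next_vertex_in[OF GC that])
  have eW: "(?e ^^ i) y \<in> ?W" if "y \<in> ?W" for y i
    by (rule funpow_next_vertex_in[OF GD that])
  note dV1 = dV[of _ 1, simplified] and eW1 = eW[of _ 1, simplified]
  have fin: "finite ?V" "finite ?W" and ne: "?V \<noteq> {}" "?W \<noteq> {}"
    using GC GD by (auto simp: finite_union_of_cycles_def pair_fin_digraph_def pair_fin_digraph_axioms_def)
  obtain M where M: "M > 0" "?d ^^ M = id"
    using funpow_next_vertex_id[OF GC] by metis
  have C_fin: "finite C"
    using fin by (simp add: C cycle_lengths_eq[OF GC])
  have C_pos: "a > 0" if "a \<in> C" for a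
    using that least_power_of_permutation(2)[OF permC]
    by (auto simp: C cycle_lengths_eq[OF GC])
  define X where "X = ?V \<rightarrow>\<^sub>E ?W"
  define N where "N = card X"
  have "finite X" "X \<noteq> {}" using fin ne by (auto simp: X_def PiE_eq_empty_iff finite_PiE)
  then have "N > 0" by (simp add: N_def card_gt_0_iff)
  \<comment> \<open>By this enumeration, a list of length \<open>N\<close> over \<open>?W\<close> is
    the value table of a function from \<open>X\<close> to \<open>?W\<close>.\<close>
  obtain t where t: "bij_betw t {..<N} X"
    using ex_bij_betw_nat_finite[OF \<open>finite X\<close>] by (auto simp: N_def lessThan_atLeast0)
  have tX: "t i \<in> X" if "i < N" for i using t that by (auto simp: bij_betw_def)
  have ex_idx: "\<exists>i<N. t i = x" if "x \<in> X" for x using t that by (auto simp: bij_betw_def image_iff)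
  have t_inj: "i = j" if "t i = t j" "i < N" "j < N" for i j
    using t that by (auto simp: bij_betw_def inj_on_def)
  have "\<forall>i\<in>{..<N}. \<exists>j. j < N \<and> t j = (\<lambda>x\<in>?V. ?e (t i x))"
  proof
    fix i assume "i \<in> {..<N}"
    then have "(\<lambda>x\<in>?V. ?e (t i x)) \<in> X" using tX[of i] eW1 by (auto simp: X_def)
    then show "\<exists>j. j < N \<and> t j = (\<lambda>x\<in>?V. ?e (t i x))" by (rule ex_idx)
  qed
  from bchoice[OF this] obtain \<tau> where \<tau>: "\<And>i. i < N \<Longrightarrow> \<tau> i < N"
    "\<And>i. i < N \<Longrightarrow> t (\<tau> i) = (\<lambda>x\<in>?V. ?e (t i x))"
    by auto
  have "\<forall>i\<in>{..<N}. \<exists>j. j < N \<and> t j = (\<lambda>x\<in>?V. t i (?d x))"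
  proof
    fix i assume "i \<in> {..<N}"
    then have "(\<lambda>x\<in>?V. t i (?d x)) \<in> X" using tX[of i] dV1 by (auto simp: X_def)
    then show "\<exists>j. j < N \<and> t j = (\<lambda>x\<in>?V. t i (?d x))" by (rule ex_idx)
  qed
  from bchoice[OF this] obtain \<rho> where \<rho>: "\<And>i. i < N \<Longrightarrow> \<rho> i < N"
    "\<And>i. i < N \<Longrightarrow> t (\<rho> i) = (\<lambda>x\<in>?V. t i (?d x))"
    by auto
  have \<tau>k: "(\<tau> ^^ k) i < N \<and> t ((\<tau> ^^ k) i) = (\<lambda>x\<in>?V. (?e ^^ k) (t i x))" if "i < N" for i k
  proof (induction k)
    case 0
    then show ?case using that tX[OF that] by (simp add: X_def)
  next
    case (Suc k)
    then show ?case using \<tau> by (simp cong: restrict_cong)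
  qed
  have \<rho>k: "(\<rho> ^^ k) i < N \<and> t ((\<rho> ^^ k) i) = (\<lambda>x\<in>?V. t i ((?d ^^ k) x))" if "i < N" for i k
  proof (induction k)
    case 0
    then show ?case using that tX[OF that] by (simp add: X_def)
  next
    case (Suc k)
    then show ?case using \<rho> dV1 by (simp add: funpow_swap1[of ?d] cong: restrict_cong)
  qed
  have \<rho>\<tau>: "\<rho> (\<tau> i) = \<tau> (\<rho> i)" if "i < N" for i
    using that \<rho> \<tau> dV1 by (intro t_inj) (simp_all cong: restrict_cong)
  \<comment> \<open>The value tables of the functions that commute with the successor map of
    \<open>GD\<close>.\<close>
  define Pol where "Pol = {xs \<in> tuples N ?W. \<forall>i<N. (xs ! i, xs ! \<tau> i) \<in> parcs GD}"
  define shift where "shift xs = map (\<lambda>i. xs ! \<rho> i) [0..<N]" for xs :: "'b list"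
  have Pol: "length xs = N" "\<And>i. i < N \<Longrightarrow> xs ! i \<in> ?W" "\<And>i. i < N \<Longrightarrow> xs ! \<tau> i = ?e (xs ! i)"
    if "xs \<in> Pol" for xs
    using that by (auto simp: Pol_def tuples_def parcs_iff_next_vertex[OF GD])
  have shift_Pol: "shift xs \<in> Pol" if "xs \<in> Pol" for xs
    using Pol[OF that] \<rho>(1) \<tau>(1) \<rho>\<tau>
    by (auto simp: Pol_def shift_def tuples_def parcs_iff_next_vertex[OF GD])
  have shiftk_Pol: "(shift ^^ k) xs \<in> Pol" if "xs \<in> Pol" for xs k
    using that shift_Pol by (induction k) auto
  have shiftk: "(shift ^^ k) xs ! i = xs ! ((\<rho> ^^ k) i)" if "i < N" for xs k i
    using that
  proof (induction k arbitrary: i)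
    case (Suc k)
    then show ?case using \<rho>(1) by (simp add: shift_def funpow_swap1)
  qed simp
  \<comment> \<open>Reindexing \<open>M\<close> times along \<open>GC\<close> is the identity on
    tuples, hence on positions.\<close>
  have shiftM: "(shift ^^ M) xs = xs" if "xs \<in> Pol" for xs
  proof (rule nth_equalityI)
    show len: "length ((shift ^^ M) xs) = length xs"
      using Pol(1)[OF that] Pol(1)[OF shiftk_Pol[OF that]] by simp
    fix i assume "i < length ((shift ^^ M) xs)"
    then have i: "i < N" using Pol(1)[OF that] len by simp
    have "(\<rho> ^^ M) i = i"
      using \<rho>k[OF i] i M(2) tX[OF i] by (intro t_inj) (auto simp: X_def)
    then show "(shift ^^ M) xs ! i = xs ! i" by (simp add: shiftk[OF i])
  qed
  \<comment> \<open>The domain has to be the full power; lists outside \<open>Pol\<close> are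
    isolated vertices.\<close>
  define Q :: "(unit, 'b list) rel_struct" where
    "Q = \<lparr>dom_of = tuples N ?W, arity_of = (\<lambda>_. 2), rel_of = (\<lambda>_. {[xs, shift xs] |xs. xs \<in> Pol})\<rparr>"
  have Pol_dom: "Pol \<subseteq> tuples N ?W" by (auto simp: Pol_def)
  have "is_structure Q"
  proof -
    obtain y where "y \<in> ?W" using ne by blast
    then have "replicate N y \<in> tuples N ?W" by (auto simp: tuples_def)
    moreover have "[xs, shift xs] \<in> tuples 2 (tuples N ?W)" if "xs \<in> Pol" for xs
      using that shift_Pol Pol_dom by (auto simp: tuples_def[of 2])
    ultimately show ?thesis by (auto simp: is_structure_def Q_def)
  qed
  moreover have "pp_definable (digraph_struct GD) (arity_of Q s * N) (concat ` rel_of Q s)" for s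
  proof -
    have "concat ` rel_of Q s = {xs @ shift xs |xs. xs \<in> Pol}"
      by (force simp: Q_def image_iff)
    then show ?thesis
      using pp_definable_polymorphism_shift[of N \<tau> \<rho> GD, OF \<open>N > 0\<close> \<tau>(1) \<rho>(1)]
      by (simp add: Q_def Pol_def shift_def)
  qed
  moreover have "isomorphic Q Q"
    by (auto simp: isomorphic_def intro!: exI[of _ id])
  ultimately have "is_pp_power (digraph_struct GD) Q"
    unfolding is_pp_power_def using \<open>N > 0\<close>
    by (intro exI[of _ N] conjI exI[of _ Q]) (auto simp: Q_def)
  \<comment> \<open>The vertex \<open>x\<close> goes to the projection to coordinate
    \<open>x\<close>; reindexing turns it into the projection to \<open>?d x\<close>.\<close>
  moreover have "is_hom (digraph_struct GC) Q (\<lambda>x. map (\<lambda>i. t i x) [0..<N])"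
  proof -
    have tW: "t i x \<in> ?W" if "i < N" "x \<in> ?V" for i x
      using tX[OF that(1)] that(2) by (auto simp: X_def)
    have "map (\<lambda>i. t i x) [0..<N] \<in> Pol" if "x \<in> ?V" for x
      using that tW \<tau> by (auto simp: Pol_def tuples_def parcs_iff_next_vertex[OF GD])
    moreover have "map (\<lambda>i. t i (?d x)) [0..<N] = shift (map (\<lambda>i. t i x) [0..<N])" if "x \<in> ?V" for x
      using that \<rho> by (simp add: shift_def)
    ultimately show ?thesis
      using Pol_dom by (auto simp: is_hom_def Q_def digraph_struct_def parcs_iff_next_vertex[OF GC])
  qed
  moreover have "\<exists>g. is_hom Q (digraph_struct GC) g"
  proof -
    \<comment> \<open>With \<open>id\<close> as second action, only the period \<open>k\<close> of
      \<open>xs\<close> under \<open>shift\<close> matters: \<open>GC\<close> needs a cycle whose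
      length divides it.\<close>
    have stab: "\<exists>y\<in>?V. \<forall>i j. (shift ^^ i) ((id ^^ j) xs) = xs \<longrightarrow> (?d ^^ i) y = y"
      if xs: "xs \<in> Pol" for xs
    proof -
      define k where "k = least_power shift xs"
      have k: "k > 0" "(shift ^^ k) xs = xs"
        using least_powerI[OF shiftM[OF xs] M(1)] by (simp_all add: k_def)
      have "\<exists>a\<in>C. a dvd k"
      proof (rule ccontr)
        assume "\<not> (\<exists>a\<in>C. a dvd k)"
        then have not_dvd: "\<not> a dvd k" if "a \<in> C" for a
          using that by blast
        obtain c where c: "c > 0" "k dvd c"
          "\<forall>m \<in> C \<ominus>\<^sub>s c. \<exists>p \<in> C \<ominus>\<^sub>s c. prime p \<and> p dvd m"
          by (rule exists_multiple_prime_type[OF C_fin C_pos k(1) not_dvd])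
        obtain h where h: "h \<in> (C \<ominus>\<^sub>s c) \<rightarrow> D"
          "\<And>a. a \<in> D \<Longrightarrow> \<not> a dvd Lcm {h b \<ominus> b |b. b \<in> C \<ominus>\<^sub>s c}"
          using cond[OF c(1,3)] by blast
        define L where "L = Lcm {h b \<ominus> b |b. b \<in> C \<ominus>\<^sub>s c}"
        \<comment> \<open>A tuple for which \<open>c\<close> steps along \<open>GC\<close> have the
          same effect as \<open>L\<close> steps along \<open>GD\<close>. A polymorphism of period
          dividing \<open>c\<close> then takes at \<open>s\<close> a value fixed by \<open>L\<close>
          steps, so the length of its cycle divides \<open>L\<close>, against the choice of
          \<open>h\<close>.\<close>
        obtain s where s: "s \<in> ?V \<rightarrow> ?W" "\<And>x. x \<in> ?V \<Longrightarrow> s ((?d ^^ c) x) = (?e ^^ L) (s x)"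
        proof (rule equivariant_map_exists[of "?d ^^ c" ?V id "?e ^^ L" ?W M 1])
          show "((?d ^^ c) ^^ M) x = x" for x
            using M(2) by (metis funpow_mult id_apply id_funpow mult.commute)
          fix x assume x: "x \<in> ?V"
          define l b where "l = least_power ?d x" and "b = l \<ominus> c"
          have "l > 0" using least_power_of_permutation(2)[OF permC] by (simp add: l_def)
          have b: "b \<in> C \<ominus>\<^sub>s c"
            using x by (auto simp: b_def l_def C cycle_lengths_eq[OF GC] dotdiv_set_def)
          \<comment> \<open>A vertex on a cycle of length \<open>h b\<close> works: every return of
            \<open>x\<close> takes a multiple of \<open>b\<close> rounds, and \<open>h b\<close>
            divides \<open>b * L\<close>.\<close>
          then obtain y where y: "y \<in> ?W" "h b = least_power ?e y"
            using h(1) by (auto simp: D cycle_lengths_eq[OF GD])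
          have "h b > 0" using y(2) least_power_of_permutation(2)[OF permD] by simp
          have "h b \<ominus> b dvd L" unfolding L_def using b by (intro dvd_Lcm) auto
          then have hbL: "h b dvd b * L" using dotdiv_dvd_iff[OF \<open>h b > 0\<close>] by simp
          have "((?e ^^ L) ^^ i) y = y" if "((?d ^^ c) ^^ i) ((id ^^ j) x) = x" for i j
          proof -
            have "(?d ^^ (c * i)) x = x" using that by (simp add: funpow_mult)
            then have "l dvd c * i" using least_power_dvd[OF permC] by (simp add: l_def)
            then have "b dvd i" using dotdiv_dvd_iff[OF \<open>l > 0\<close>] by (simp add: b_def)
            then have "h b dvd L * i"
              using hbL by (metis dvd_trans mult.commute mult_dvd_mono dvd_refl)
            then have "(?e ^^ (L * i)) y = y"
              using least_power_dvd[OF permD] y(2) by simp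
            then show ?thesis by (simp add: funpow_mult)
          qed
          then show "\<exists>y\<in>?W. \<forall>i j. ((?d ^^ c) ^^ i) ((id ^^ j) x) = x \<longrightarrow> ((?e ^^ L) ^^ i) y = y"
            using y(1) by blast
        qed (use dV eW M(1) in auto)
        obtain p where p: "p < N" "t p = restrict s ?V"
          using ex_idx[of "restrict s ?V"] s(1) by (auto simp: X_def)
        \<comment> \<open>The defining property of \<open>s\<close>, expressed in positions.\<close>
        have "(\<rho> ^^ c) p = (\<tau> ^^ L) p"
          using \<rho>k[OF p(1)] \<tau>k[OF p(1)] dV s(2)
          by (intro t_inj) (auto simp: p(2) cong: restrict_cong)
        moreover have "(shift ^^ c) xs = xs"
        proof -
          obtain j where "c = k * j" using c(2) by blast
          moreover have "((shift ^^ k) ^^ j) xs = xs" using k(2) by (induction j) simp_all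
          ultimately show ?thesis by (simp add: funpow_mult)
        qed
        then have "xs ! ((\<rho> ^^ c) p) = xs ! p" using shiftk[OF p(1), of c xs] by simp
        moreover have "xs ! ((\<tau> ^^ j) p) = (?e ^^ j) (xs ! p)" for j
          using Pol(3)[OF xs] \<tau>k[OF p(1)] by (induction j) auto
        ultimately have "(?e ^^ L) (xs ! p) = xs ! p" by metis
        then have "least_power ?e (xs ! p) dvd L" using least_power_dvd[OF permD] by blast
        moreover have "least_power ?e (xs ! p) \<in> D"
          using Pol(2)[OF xs p(1)] by (simp add: D cycle_lengths_eq[OF GD])
        ultimately show False using h(2) by (simp add: L_def)
      qed
      then obtain y where y: "y \<in> ?V" "least_power ?d y dvd k"
        by (auto simp: C cycle_lengths_eq[OF GC])
      have "(?d ^^ i) y = y" if "(shift ^^ i) ((id ^^ j) xs) = xs" for i j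
      proof -
        have "k dvd i" using that least_power_minimal by (simp add: k_def)
        then show ?thesis using y(2) least_power_dvd[OF permC] dvd_trans by blast
      qed
      then show ?thesis using y(1) by blast
    qed
    obtain u where u: "u \<in> Pol \<rightarrow> ?V" "\<And>xs. xs \<in> Pol \<Longrightarrow> u (shift xs) = ?d (u xs)"
      using equivariant_map_exists[of shift Pol id ?d ?V M 1, OF _ _ _ _ M(1) shiftM _ _ stab]
        shift_Pol dV1 by auto
    obtain v where "v \<in> ?V" using ne by blast
    \<comment> \<open>Isolated vertices may go anywhere, here to \<open>v\<close>.\<close>
    then have "is_hom Q (digraph_struct GC) (\<lambda>xs. if xs \<in> Pol then u xs else v)"
      using u shift_Pol
      by (auto simp: is_hom_def Q_def digraph_struct_def parcs_iff_next_vertex[OF GC])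
    then show ?thesis by blast
  qed
  ultimately show ?thesis
    unfolding pp_constructs_def hom_equivalent_def by blast
qed

theorem corollary2p58:
  fixes GC :: "'a pair_pre_digraph" and GD :: "'b pair_pre_digraph"
    and C D :: "nat set"
  assumes "finite_union_of_cycles GC" and "finite_union_of_cycles GD"
    and "C = cycle_lengths GC" and "D = cycle_lengths GD"
  shows "pp_constructs (digraph_struct GD) (digraph_struct GC) \<longleftrightarrow>
    (\<forall>c :: nat. c > 0 \<longrightarrow>
      (\<forall>m \<in> C \<ominus>\<^sub>s c. \<exists>p \<in> C \<ominus>\<^sub>s c. prime p \<and> p dvd m) \<longrightarrow>
      (\<exists>h :: nat \<Rightarrow> nat. h \<in> (C \<ominus>\<^sub>s c) \<rightarrow> D \<and>
        (\<forall>a \<in> D. \<not> a dvd Lcm {h b \<ominus> b |b. b \<in> C \<ominus>\<^sub>s c})))"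
  using pp_constructs_imp_lcm_condition[OF assms] lcm_condition_imp_pp_constructs[OF assms]
  by blast

end
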